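(* Let $H$ be a finite hypergraph, let $\mathfrak{R}$ be an equivalence relation on $V(H)$, let $T:\mathbb{C}^{V(H)}\to\mathbb{C}^{V(H)}$ be an $\mathfrak{R}$-compatible linear operator, and let $W$ be an $\mathfrak{R}$-equivalence class with $|W|>1$. Then $\lambda_{(W,T)}$ is an eigenvalue of $T$ with multiplicity at least $|W|-1$, and $S_W$ is a subspace of the eigenspace of $\lambda_{(W,T)}$.
   Context: A (finite) hypergraph $H$ is a pair $(V(H),E(H))$, where $V(H)$ is a non-empty finite set and $E(H)$ is a collection of non-empty subsets of $V(H)$. $\mathbb{C}^{V(H)}$ is the vector space of all functions $V(H)\to\mathbb{C}$. For $U\subseteq V(H)$, $\chi_U$ is the characteristic function of $U$. For distinct $u,v\in V(H)$, $x_{uv}=\chi_{\{v\}}-\chi_{\{u\}}$. For distinct $u,v\in V(H)$, $\phi_{uv}:V(H)\to V(H)$ is the transposition that interchanges $u$ and $v$ and fixes every other vertex. Given an equivalence relation $\mathfrak{R}$ on $V(H)$, a linear map $T:\mathbb{C}^{V(H)}\to\mathbb{C}^{V(H)}$ is called $\mathfrak{R}$-compatible if for every $\mathfrak{R}$-equivalence class $W$, every pair $\{u,v\}\subseteq W$ and every $x\in\mathbb{C}^{V(H)}$, $(Tx)\circ\phi_{uv}=T(x\circ\phi_{uv})$. For an $\mathfrak{R}$-compatible $T$ and an $\mathfrak{R}$-equivalence class $W$ with $|W|>1$, the number $(Tx_{uv})(v)$ is the same for all distinct $u,v\in W$; this constant is denoted $\lambda_{(W,T)}$. For $U\subseteq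 V(H)$, $S_U=\{x\in\mathbb{C}^{V(H)}: \{v\in V(H): x(v)\neq 0\}\subseteq U \text{ and } \sum_{v\in U}x(v)=0\}$. *)

theory Defs
  imports Complex_Main "HOL-Library.Function_Algebras" "HOL-Library.Indicator_Function"
    "HOL-Combinatorics.Transposition"
begin

type_synonym 'v hypergraph = "'v set \<times> 'v set set"

abbreviation verts :: "'v hypergraph \<Rightarrow> 'v set" where "verts \<equiv> fst"
abbreviation edges :: "'v hypergraph \<Rightarrow> 'v set set" where "edges \<equiv> snd"

definition finite_hypergraph :: "'v hypergraph \<Rightarrow> bool" where
  "finite_hypergraph H \<longleftrightarrow>
     finite (verts H) \<and> verts H \<noteq> {} \<and> (\<forall>e\<in>edges H. e \<noteq> {} \<and> e \<subseteq> verts H)"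

text \<open>A complex-valued function on the vertex set \<open>V\<close> is represented by its extension by zero
  to the whole type, so that the space of these functions is a linear subspace of the complex
  vector space \<open>'v \<Rightarrow> complex\<close>.\<close>

definition scale_fun :: "complex \<Rightarrow> ('v \<Rightarrow> complex) \<Rightarrow> ('v \<Rightarrow> complex)" where
  "scale_fun c x = (\<lambda>v. c * x v)"

global_interpretation cfun: vector_space scale_fun
  by unfold_locales (auto simp: scale_fun_def fun_eq_iff algebra_simps)

definition vertex_space :: "'v set \<Rightarrow> ('v \<Rightarrow> complex) set" where
  "vertex_space V = {x. \<forall>v. v \<notin> V \<longrightarrow> x v = 0}"

text \<open>Operators are total functions in HOL; only their values on \<open>vertex_space V\<close> matter.\<close>

definition linear_operator :: "'v set \<Rightarrow> (('v \<Rightarrow> complex) \<Rightarrow> ('v \<Rightarrow> complex)) \<Rightarrow> bool" where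
  "linear_operator V T \<longleftrightarrow>
     T ` vertex_space V \<subseteq> vertex_space V \<and>
     (\<forall>x\<in>vertex_space V. \<forall>y\<in>vertex_space V. T (x + y) = T x + T y) \<and>
     (\<forall>c. \<forall>x\<in>vertex_space V. T (scale_fun c x) = scale_fun c (T x))"

definition compatible ::
    "'v set \<Rightarrow> 'v rel \<Rightarrow> (('v \<Rightarrow> complex) \<Rightarrow> ('v \<Rightarrow> complex)) \<Rightarrow> bool" where
  "compatible V R T \<longleftrightarrow>
     (\<forall>W\<in>V // R. \<forall>u\<in>W. \<forall>v\<in>W. u \<noteq> v \<longrightarrow>
        (\<forall>x\<in>vertex_space V. T x \<circ> transpose u v = T (x \<circ> transpose u v)))"

definition diff_vec :: "'v \<Rightarrow> 'v \<Rightarrow> ('v \<Rightarrow> complex)" where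
  "diff_vec u v = indicator {v} - indicator {u}"

text \<open>The common value of \<open>T (diff_vec u v) v\<close>; its existence and uniqueness is
  \<open>lambda_eq\<close> below.\<close>

definition lambda :: "'v set \<Rightarrow> (('v \<Rightarrow> complex) \<Rightarrow> ('v \<Rightarrow> complex)) \<Rightarrow> complex" where
  "lambda W T = (THE c. \<forall>u\<in>W. \<forall>v\<in>W. u \<noteq> v \<longrightarrow> T (diff_vec u v) v = c)"

definition zero_sum_space :: "'v set \<Rightarrow> 'v set \<Rightarrow> ('v \<Rightarrow> complex) set" where
  "zero_sum_space V U = {x \<in> vertex_space V. {v \<in> V. x v \<noteq> 0} \<subseteq> U \<and> (\<Sum>v\<in>U. x v) = 0}"

definition eigenspace ::
    "'v set \<Rightarrow> (('v \<Rightarrow> complex) \<Rightarrow> ('v \<Rightarrow> complex)) \<Rightarrow> complex \<Rightarrow> ('v \<Rightarrow> complex) set" where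
  "eigenspace V T c = {x \<in> vertex_space V. T x = scale_fun c x}"

definition eigenvalue ::
    "'v set \<Rightarrow> (('v \<Rightarrow> complex) \<Rightarrow> ('v \<Rightarrow> complex)) \<Rightarrow> complex \<Rightarrow> bool" where
  "eigenvalue V T c \<longleftrightarrow> (\<exists>x\<in>vertex_space V. x \<noteq> 0 \<and> T x = scale_fun c x)"

definition geometric_multiplicity ::
    "'v set \<Rightarrow> (('v \<Rightarrow> complex) \<Rightarrow> ('v \<Rightarrow> complex)) \<Rightarrow> complex \<Rightarrow> nat" where
  "geometric_multiplicity V T c = cfun.dim (eigenspace V T c)"

lemma diff_vec_transpose:
  "diff_vec u v \<circ> transpose a b = diff_vec (transpose a b u) (transpose a b v)"
  by (auto simp: diff_vec_def fun_eq_iff indicator_def transpose_eq_iff transpose_def)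

lemma lambda_eq:
  assumes R: "equiv V R" and W: "W \<in> V // R" and T: "compatible V R T"
    and uv: "u \<in> W" "v \<in> W" "u \<noteq> v"
  shows "lambda W T = T (diff_vec u v) v"
proof -
  have "W \<subseteq> V"
    using R W by (rule in_quotient_imp_subset)
  have step: "T (diff_vec (transpose a b s) (transpose a b t)) (transpose a b t) = T (diff_vec s t) t"
    if "a \<in> W" "b \<in> W" "s \<in> W" "t \<in> W" for a b s t
  proof (cases "a = b")
    case False
    have "diff_vec s t \<in> vertex_space V"
      using that \<open>W \<subseteq> V\<close> by (auto simp: diff_vec_def vertex_space_def indicator_def)
    with T W that False have "T (diff_vec s t) \<circ> transpose a b = T (diff_vec s t \<circ> transpose a b)"
      unfolding compatible_def by blast
    then show ?thesis
      by (metis comp_apply diff_vec_transpose transpose_involutory)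
  qed auto
  have eq: "T (diff_vec s t) t = T (diff_vec u v) v" if st: "s \<in> W" "t \<in> W" "s \<noteq> t" for s t
  proof -
    define s' where "s' = transpose t v s"
    have s': "s' \<in> W" "s' \<noteq> v"
      using st uv by (auto simp: s'_def transpose_def)
    have "T (diff_vec s t) t = T (diff_vec s' v) v"
      using step[of t v s t] st uv by (simp add: s'_def)
    also have "\<dots> = T (diff_vec u v) v"
      using step[of s' u s' v] s' uv by (simp add: transpose_def)
    finally show ?thesis .
  qed
  show ?thesis
    unfolding lambda_def
  proof (rule the_equality)
    show "\<forall>s\<in>W. \<forall>t\<in>W. s \<noteq> t \<longrightarrow> T (diff_vec s t) t = T (diff_vec u v) v"
      using eq by blast
  qed (use uv in blast)
qed

end

theory Submission
  imports Defs
begin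

text \<open>
  Write \<open>x\<close> for \<open>diff_vec u v\<close> with distinct \<open>u\<close>, \<open>v\<close> in \<open>W\<close>. The transposition of \<open>u\<close> and \<open>v\<close> maps
  \<open>x\<close> to \<open>- x\<close>, so by compatibility it maps \<open>T x\<close> to \<open>- T x\<close>. An antisymmetric function
  vanishes away from \<open>u\<close> and \<open>v\<close> and takes opposite values at these two points, hence \<open>T x\<close> is a
  multiple of \<open>x\<close>; the factor is its value at \<open>v\<close>, which is \<open>lambda W T\<close>
  (lemma \<open>diff_vec_in_eigenspace\<close>).

  Now fix \<open>u\<close>. The vectors \<open>diff_vec u v\<close>, with \<open>v\<close> running over the other elements of \<open>W\<close>, are
  linearly independent (\<open>independent_diff_vecs\<close>) and span the zero-sum functions on \<open>W\<close>
  (\<open>zero_sum_expansion\<close>). As the eigenspace is closed under linear combinations, it contains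
  all zero-sum functions, and independence makes its dimension at least \<open>card W - 1\<close>.
\<close>

lemma sum_scale_fun_apply: "(\<Sum>a\<in>A. scale_fun (c a) (f a)) w = (\<Sum>a\<in>A. c a * f a w)"
  by (induction A rule: infinite_finite_induct) (auto simp: scale_fun_def)

lemma vertex_space_subspace: "cfun.subspace (vertex_space V)"
  unfolding cfun.subspace_def by (auto simp: vertex_space_def scale_fun_def)

lemma vertex_space_subset_span:
  assumes "finite V"
  shows "vertex_space V \<subseteq> cfun.span ((\<lambda>v. indicator {v}) ` V)"
proof
  fix x :: "'a \<Rightarrow> complex"
  assume x: "x \<in> vertex_space V"
  have "x = (\<Sum>v\<in>V. scale_fun (x v) (indicator {v}))"
  proof
    fix w
    have "(\<Sum>v\<in>V. x v * indicator {v} w) = (\<Sum>v\<in>V. if v = w then x w else 0)"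
      by (rule sum.cong) (auto simp: indicator_def)
    also have "\<dots> = x w"
      using assms x by (simp add: vertex_space_def)
    finally show "x w = (\<Sum>v\<in>V. scale_fun (x v) (indicator {v})) w"
      by (simp add: sum_scale_fun_apply)
  qed
  moreover have "(\<Sum>v\<in>V. scale_fun (x v) (indicator {v})) \<in> cfun.span ((\<lambda>v. indicator {v}) ` V)"
    by (intro cfun.span_sum cfun.span_scale cfun.span_base imageI)
  ultimately show "x \<in> cfun.span ((\<lambda>v. indicator {v}) ` V)"
    by simp
qed

text \<open>The ambient space \<open>'v \<Rightarrow> complex\<close> may be infinite-dimensional, and \<open>cfun.dim\<close> takes the
  value 0 on its infinite-dimensional subspaces, so finite dimension has to be established first. Containment in \<open>vertex_space V\<close> provides this, by
  bounding the size of every independent set.\<close>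

lemma card_independent_le_dim:
  assumes "finite V" and "E \<subseteq> vertex_space V" and "B \<subseteq> E" and "cfun.independent B"
  shows "card B \<le> cfun.dim E"
proof -
  obtain C where C: "C \<subseteq> E" "cfun.independent C" "E \<subseteq> cfun.span C" "card C = cfun.dim E"
    using cfun.basis_exists by blast
  have "finite C"
    using cfun.independent_span_bound[of "(\<lambda>v. indicator {v}) ` V" C] C(1,2) assms(1,2)
      vertex_space_subset_span[OF assms(1)] by blast
  then show ?thesis
    using cfun.independent_span_bound[of C B] assms(3,4) C(3,4) by auto
qed

lemma eigenspace_subspace:
  assumes "linear_operator V T"
  shows "cfun.subspace (eigenspace V T c)"
proof -
  have zero: "0 \<in> vertex_space V"
    by (rule cfun.subspace_0[OF vertex_space_subspace])
  have "T (scale_fun 0 0) = scale_fun 0 (T 0)"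
    using assms zero unfolding linear_operator_def by blast
  then have "T 0 = 0"
    by simp
  then have "0 \<in> eigenspace V T c"
    using zero by (simp add: eigenspace_def)
  moreover have "x + y \<in> eigenspace V T c"
    if "x \<in> eigenspace V T c" "y \<in> eigenspace V T c" for x y
  proof -
    have "T (x + y) = T x + T y"
      using assms that unfolding linear_operator_def eigenspace_def by blast
    then show ?thesis
      using that cfun.subspace_add[OF vertex_space_subspace[of V]]
      by (simp add: eigenspace_def cfun.scale_right_distrib)
  qed
  moreover have "scale_fun a x \<in> eigenspace V T c" if "x \<in> eigenspace V T c" for a x
  proof -
    have "T (scale_fun a x) = scale_fun a (T x)"
      using assms that unfolding linear_operator_def eigenspace_def by blast
    then show ?thesis
      using that cfun.subspace_scale[OF vertex_space_subspace[of V]]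
      by (simp add: eigenspace_def mult.commute)
  qed
  ultimately show ?thesis
    unfolding cfun.subspace_def by blast
qed

lemma zero_sum_space_subspace: "cfun.subspace (zero_sum_space V U)"
proof -
  have "zero_sum_space V U = {x. (\<forall>v. v \<notin> V \<inter> U \<longrightarrow> x v = 0) \<and> (\<Sum>v\<in>U. x v) = 0}"
    by (auto simp: zero_sum_space_def vertex_space_def)
  then show ?thesis
    unfolding cfun.subspace_def
    by (auto simp: scale_fun_def sum.distrib simp flip: sum_distrib_left)
qed

lemma diff_vec_nonzero: "u \<noteq> v \<Longrightarrow> diff_vec u v \<noteq> 0"
  by (auto simp: diff_vec_def indicator_def fun_eq_iff)

text \<open>This is where compatibility enters: \<open>T (diff_vec u v)\<close> inherits from \<open>diff_vec u v\<close> its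
  antisymmetry under the transposition of \<open>u\<close> and \<open>v\<close>, and only the multiples of
  \<open>diff_vec u v\<close> are antisymmetric.\<close>

lemma diff_vec_in_eigenspace:
  assumes R: "equiv V R" and W: "W \<in> V // R" and lin: "linear_operator V T"
    and T: "compatible V R T" and uv: "u \<in> W" "v \<in> W" "u \<noteq> v"
  shows "diff_vec u v \<in> eigenspace V T (lambda W T)"
proof -
  define y where "y = T (diff_vec u v)"
  have "W \<subseteq> V"
    using R W by (rule in_quotient_imp_subset)
  then have mem: "diff_vec u v \<in> vertex_space V"
    using uv by (auto simp: diff_vec_def vertex_space_def indicator_def)
  have "y \<circ> transpose u v = T (diff_vec u v \<circ> transpose u v)"
    using T W uv mem unfolding compatible_def y_def by blast
  also have "diff_vec u v \<circ> transpose u v = scale_fun (-1) (diff_vec u v)"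
    by (simp add: diff_vec_transpose) (simp add: diff_vec_def scale_fun_def fun_eq_iff)
  also have "T \<dots> = scale_fun (-1) y"
    using lin mem unfolding linear_operator_def y_def by blast
  finally have anti: "y (transpose u v w) = - y w" for w
    by (simp add: fun_eq_iff scale_fun_def)
  have "y w = y v * diff_vec u v w" for w
    using anti[of w] uv(3) by (auto simp: transpose_def diff_vec_def indicator_def split: if_splits)
  then have "y = scale_fun (y v) (diff_vec u v)"
    unfolding scale_fun_def by blast
  moreover have "lambda W T = y v"
    unfolding y_def by (rule lambda_eq[OF R W T uv])
  ultimately show ?thesis
    using mem unfolding eigenspace_def y_def by simp
qed

lemma sum_diff_vec_apply:
  assumes "finite A" and "u \<notin> A"
  shows "(\<Sum>v\<in>A. c v * diff_vec u v w) = (if w \<in> A then c w else if w = u then - sum c A else 0)"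
proof (cases "w = u")
  case True
  then have "(\<Sum>v\<in>A. c v * diff_vec u v w) = (\<Sum>v\<in>A. - c v)"
    using assms by (intro sum.cong) (auto simp: diff_vec_def indicator_def)
  then show ?thesis
    using True assms by (simp add: sum_negf)
next
  case False
  then have "(\<Sum>v\<in>A. c v * diff_vec u v w) = (\<Sum>v\<in>A. if v = w then c w else 0)"
    by (intro sum.cong) (auto simp: diff_vec_def indicator_def)
  then show ?thesis
    using False assms by simp
qed

text \<open>Both sides clearly agree away from \<open>u\<close>, and for both the value at \<open>u\<close> is determined by the
  others through the zero-sum condition.\<close>

lemma zero_sum_expansion:
  assumes "finite U" and "U \<subseteq> V" and "u \<in> U" and x: "x \<in> zero_sum_space V U"
  shows "x = (\<Sum>v\<in>U - {u}. scale_fun (x v) (diff_vec u v))"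
proof
  fix w
  have "x u = - sum x (U - {u})"
    using x assms(1,3) by (simp add: zero_sum_space_def sum.remove add_eq_0_iff2)
  moreover have "x w = 0" if "w \<notin> U"
    using x that by (auto simp: zero_sum_space_def vertex_space_def)
  ultimately show "x w = (\<Sum>v\<in>U - {u}. scale_fun (x v) (diff_vec u v)) w"
    using assms(1) by (auto simp: sum_scale_fun_apply sum_diff_vec_apply)
qed

lemma inj_on_diff_vec: "inj_on (diff_vec u) (- {u})"
proof (rule inj_onI)
  fix v w
  assume vw: "v \<in> - {u}" "w \<in> - {u}" "diff_vec u v = diff_vec u w"
  then have "diff_vec u v v = diff_vec u w v"
    by simp
  with vw(1,2) show "v = w"
    by (auto simp: diff_vec_def indicator_def split: if_splits)
qed

lemma independent_diff_vecs:
  assumes "finite A" and "u \<notin> A"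
  shows "cfun.independent (diff_vec u ` A)"
proof (rule cfun.independent_if_scalars_zero)
  fix f x
  assume sum0: "(\<Sum>x\<in>diff_vec u ` A. scale_fun (f x) x) = 0" and "x \<in> diff_vec u ` A"
  then obtain v where v: "v \<in> A" "x = diff_vec u v"
    by blast
  have "inj_on (diff_vec u) A"
    using assms(2) by (intro inj_on_subset[OF inj_on_diff_vec]) auto
  then have "(\<Sum>w\<in>A. scale_fun (f (diff_vec u w)) (diff_vec u w)) v = 0"
    using sum0 by (simp add: sum.reindex)
  \<comment> \<open>At the point \<open>v\<close>, only \<open>diff_vec u v\<close> is nonzero.\<close>
  then show "f x = 0"
    using v assms by (simp add: sum_scale_fun_apply sum_diff_vec_apply)
qed (use assms in simp)

theorem theorem2p6:
  fixes H :: "'v hypergraph" and R :: "'v rel" and W :: "'v set"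
    and T :: "('v \<Rightarrow> complex) \<Rightarrow> ('v \<Rightarrow> complex)"
  assumes "finite_hypergraph H"
    and "equiv (verts H) R"
    and "linear_operator (verts H) T"
    and "compatible (verts H) R T"
    and "W \<in> verts H // R"
    and "card W > 1"
  shows "eigenvalue (verts H) T (lambda W T)
    \<and> geometric_multiplicity (verts H) T (lambda W T) \<ge> card W - 1
    \<and> cfun.subspace (zero_sum_space (verts H) W)
    \<and> zero_sum_space (verts H) W \<subseteq> eigenspace (verts H) T (lambda W T)"
proof -
  let ?V = "verts H" and ?E = "eigenspace (verts H) T (lambda W T)"
  have finV: "finite ?V"
    using assms(1) by (simp add: finite_hypergraph_def)
  have WV: "W \<subseteq> ?V"
    using assms(2,5) by (rule in_quotient_imp_subset)
  have finW: "finite W"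
    using finV WV by (rule rev_finite_subset)
  obtain u where u: "u \<in> W"
    using assms(6) by fastforce
  let ?B = "diff_vec u ` (W - {u})"
  have card_B: "card ?B = card W - 1"
    using u finW by (subst card_image) (auto intro: inj_on_subset[OF inj_on_diff_vec])
  have B_E: "diff_vec u v \<in> ?E" if "v \<in> W - {u}" for v
    using diff_vec_in_eigenspace[OF assms(2,5,3,4) u] that by auto
  have "card ?B \<le> cfun.dim ?E"
    using B_E finW by (intro card_independent_le_dim[OF finV] independent_diff_vecs)
      (auto simp: eigenspace_def)
  then have mult: "geometric_multiplicity ?V T (lambda W T) \<ge> card W - 1"
    by (simp add: geometric_multiplicity_def card_B)
  have "W - {u} \<noteq> {}"
    using card_B assms(6) by fastforce
  then obtain v where v: "v \<in> W - {u}"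
    by blast
  have ev: "eigenvalue ?V T (lambda W T)"
    using B_E[OF v] diff_vec_nonzero[of u v] v unfolding eigenvalue_def eigenspace_def by blast
  have "zero_sum_space ?V W \<subseteq> ?E"
  proof
    fix x
    assume "x \<in> zero_sum_space ?V W"
    then have "x = (\<Sum>v\<in>W - {u}. scale_fun (x v) (diff_vec u v))"
      by (rule zero_sum_expansion[OF finW WV u])
    moreover have "(\<Sum>v\<in>W - {u}. scale_fun (x v) (diff_vec u v)) \<in> ?E"
      using B_E eigenspace_subspace[OF assms(3)]
      by (intro cfun.subspace_sum cfun.subspace_scale) auto
    ultimately show "x \<in> ?E"
      by simp
  qed
  with ev mult zero_sum_space_subspace show ?thesis
    by blast
qed

end
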